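(* Let $G$ be a finite group, let $R:=\mathbb{Z}_{\geq 0}[G]$ be its group semiring over $\mathbb{Z}_{\geq 0}$, and let $M$ be a proper $R$-semimodule. Then the following conditions are equivalent: (i) $M$ is minimal; (ii) $M$ is elementary; (iii) $M$ is simple; (iv) $M$ is isomorphic to ${}_R\mathbf{B}$.
   Context: A semiring is a tuple $(R,+,\cdot,0,1)$ where $(R,+,0)$ is a commutative monoid, $(R,\cdot,1)$ is a monoid, multiplication distributes over addition on both sides, and $0a=a0=0$ for all $a\in R$. A (left) $R$-semimodule is a commutative monoid $(M,+,0_M)$ with a map $R\times M\to M$, $(r,m)\mapsto r(m)$, such that $r(m+n)=r(m)+r(n)$, $r(0_M)=0_M$, $(r+s)(m)=r(m)+s(m)$, $(rs)(m)=r(s(m))$, $0(m)=0_M$, $1(m)=m$. It is called an $R$-module if $M$ is an abelian group, and a proper semimodule if it is not a module. Homomorphisms of semimodules are monoid homomorphisms commuting with the action of $R$. A subsemimodule is a submonoid closed under the action of $R$. An $R$-congruence on $M$ is an equivalence relation $\sim$ such that $m\sim n$ implies $m+k\sim n+k$ for all $k\in M$ and $r(m)\sim r(n)$ for all $r\in R$. A non-zero $R$-semimodule $M$ is called minimal if its only subsemimodules are $\{0_M\}$ and $M$; elementary if its only $R$-congruences are the equality relation and the full relation $M\times M$; simple if it is both minimal and elementary. ${}_R\mathbf{B}$ is the $R$-semimodule with underlying monoid $(\{0,1\},+,0)$, where $1+1=1$, on which $i\in\mathbb{Z}_{\geq 0}$ acts as zero if $i=0$ and as the identity if $i>0$, and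 every $g\in G$ acts as the identity. *)

theory Defs
  imports "HOL-Algebra.Module"
begin

section \<open>Semimodules over a semiring\<close>

text \<open>As for modules in the library, only the fields carrier, add, zero and smult of the record
  M are meaningful; the multiplicative fields inherited from the ring record are ignored.\<close>

locale semimodule = R?: semiring R + M?: abelian_monoid M
  for R (structure) and M :: "('a, 'b, 'c) module_scheme" (structure) +
  assumes smult_closed [simp, intro]:
      "\<lbrakk>a \<in> carrier R; x \<in> carrier M\<rbrakk> \<Longrightarrow> a \<odot>\<^bsub>M\<^esub> x \<in> carrier M"
    and smult_r_distr:
      "\<lbrakk>a \<in> carrier R; x \<in> carrier M; y \<in> carrier M\<rbrakk> \<Longrightarrow>
        a \<odot>\<^bsub>M\<^esub> (x \<oplus>\<^bsub>M\<^esub> y) = a \<odot>\<^bsub>M\<^esub> x \<oplus>\<^bsub>M\<^esub> a \<odot>\<^bsub>M\<^esub> y"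
    and smult_r_null [simp]:
      "a \<in> carrier R \<Longrightarrow> a \<odot>\<^bsub>M\<^esub> \<zero>\<^bsub>M\<^esub> = \<zero>\<^bsub>M\<^esub>"
    and smult_l_distr:
      "\<lbrakk>a \<in> carrier R; b \<in> carrier R; x \<in> carrier M\<rbrakk> \<Longrightarrow>
        (a \<oplus>\<^bsub>R\<^esub> b) \<odot>\<^bsub>M\<^esub> x = a \<odot>\<^bsub>M\<^esub> x \<oplus>\<^bsub>M\<^esub> b \<odot>\<^bsub>M\<^esub> x"
    and smult_assoc1:
      "\<lbrakk>a \<in> carrier R; b \<in> carrier R; x \<in> carrier M\<rbrakk> \<Longrightarrow>
        (a \<otimes>\<^bsub>R\<^esub> b) \<odot>\<^bsub>M\<^esub> x = a \<odot>\<^bsub>M\<^esub> (b \<odot>\<^bsub>M\<^esub> x)"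
    and smult_l_null [simp]:
      "x \<in> carrier M \<Longrightarrow> \<zero>\<^bsub>R\<^esub> \<odot>\<^bsub>M\<^esub> x = \<zero>\<^bsub>M\<^esub>"
    and smult_one [simp]:
      "x \<in> carrier M \<Longrightarrow> \<one>\<^bsub>R\<^esub> \<odot>\<^bsub>M\<^esub> x = x"

locale proper_semimodule = semimodule +
  assumes not_abelian_group: "\<not> abelian_group M"

definition semimodule_hom ::
    "('a, 'r) ring_scheme \<Rightarrow> ('a, 'b, 'c) module_scheme \<Rightarrow> ('a, 'd, 'e) module_scheme
      \<Rightarrow> ('b \<Rightarrow> 'd) set" where
  "semimodule_hom R M N =
    {f \<in> hom (add_monoid M) (add_monoid N).
       f \<zero>\<^bsub>M\<^esub> = \<zero>\<^bsub>N\<^esub> \<and>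
       (\<forall>a\<in>carrier R. \<forall>x\<in>carrier M. f (a \<odot>\<^bsub>M\<^esub> x) = a \<odot>\<^bsub>N\<^esub> f x)}"

definition semimodule_isomorphic ::
    "('a, 'r) ring_scheme \<Rightarrow> ('a, 'b, 'c) module_scheme \<Rightarrow> ('a, 'd, 'e) module_scheme \<Rightarrow> bool" where
  "semimodule_isomorphic R M N \<longleftrightarrow>
    (\<exists>f\<in>semimodule_hom R M N. bij_betw f (carrier M) (carrier N))"

definition subsemimodule ::
    "('a, 'r) ring_scheme \<Rightarrow> 'b set \<Rightarrow> ('a, 'b, 'c) module_scheme \<Rightarrow> bool" where
  "subsemimodule R N M \<longleftrightarrow>
    submonoid N (add_monoid M) \<and> (\<forall>a\<in>carrier R. \<forall>x\<in>N. a \<odot>\<^bsub>M\<^esub> x \<in> N)"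

definition semimodule_congruence ::
    "('a, 'r) ring_scheme \<Rightarrow> ('a, 'b, 'c) module_scheme \<Rightarrow> ('b \<times> 'b) set \<Rightarrow> bool" where
  "semimodule_congruence R M E \<longleftrightarrow>
    equiv (carrier M) E \<and>
    (\<forall>(m, n)\<in>E. (\<forall>k\<in>carrier M. (m \<oplus>\<^bsub>M\<^esub> k, n \<oplus>\<^bsub>M\<^esub> k) \<in> E) \<and>
                 (\<forall>a\<in>carrier R. (a \<odot>\<^bsub>M\<^esub> m, a \<odot>\<^bsub>M\<^esub> n) \<in> E))"

definition minimal_semimodule ::
    "('a, 'r) ring_scheme \<Rightarrow> ('a, 'b, 'c) module_scheme \<Rightarrow> bool" where
  "minimal_semimodule R M \<longleftrightarrow>
    semimodule R M \<and> carrier M \<noteq> {\<zero>\<^bsub>M\<^esub>} \<and>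
    (\<forall>N. subsemimodule R N M \<longrightarrow> N = {\<zero>\<^bsub>M\<^esub>} \<or> N = carrier M)"

definition elementary_semimodule ::
    "('a, 'r) ring_scheme \<Rightarrow> ('a, 'b, 'c) module_scheme \<Rightarrow> bool" where
  "elementary_semimodule R M \<longleftrightarrow>
    semimodule R M \<and> carrier M \<noteq> {\<zero>\<^bsub>M\<^esub>} \<and>
    (\<forall>E. semimodule_congruence R M E \<longrightarrow> E = Id_on (carrier M) \<or> E = carrier M \<times> carrier M)"

definition simple_semimodule ::
    "('a, 'r) ring_scheme \<Rightarrow> ('a, 'b, 'c) module_scheme \<Rightarrow> bool" where
  "simple_semimodule R M \<longleftrightarrow> minimal_semimodule R M \<and> elementary_semimodule R M"


section \<open>The group semiring of a finite group over the natural numbers\<close>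

text \<open>An element \<open>\<Sum>\<^sub>g n\<^sub>g g\<close> is its coefficient function, extended by undefined outside of the
  carrier of G. All functions on the carrier are admitted (no finite-support condition), so this is
  the group semiring only for finite G.\<close>

definition nat_group_semiring :: "('g, 'x) monoid_scheme \<Rightarrow> ('g \<Rightarrow> nat) ring" where
  "nat_group_semiring G =
    \<lparr>carrier = carrier G \<rightarrow>\<^sub>E UNIV,
     mult = (\<lambda>r s. \<lambda>x\<in>carrier G. \<Sum>y\<in>carrier G. r y * s (inv\<^bsub>G\<^esub> y \<otimes>\<^bsub>G\<^esub> x)),
     one = (\<lambda>x\<in>carrier G. if x = \<one>\<^bsub>G\<^esub> then 1 else 0),
     zero = (\<lambda>x\<in>carrier G. 0),
     add = (\<lambda>r s. \<lambda>x\<in>carrier G. r x + s x)\<rparr>"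

text \<open>The element \<open>i g\<close> of the group semiring; the canonical images of \<open>i\<close> and of \<open>g\<close>
  are \<open>nat_group_monom G i \<one>\<close> and \<open>nat_group_monom G 1 g\<close>.\<close>

definition nat_group_monom :: "('g, 'x) monoid_scheme \<Rightarrow> nat \<Rightarrow> 'g \<Rightarrow> 'g \<Rightarrow> nat" where
  "nat_group_monom G i g = (\<lambda>x\<in>carrier G. if x = g then i else 0)"

text \<open>Since \<open>i g\<close> acts as zero if \<open>i = 0\<close> and as the identity otherwise, and \<open>x + x = x\<close>, a sum
  \<open>\<Sum>\<^sub>g n\<^sub>g g\<close> acts as the identity if some \<open>n\<^sub>g\<close> is positive, and as zero otherwise.
  The multiplicative fields are fillers.\<close>

definition semimodule_B :: "('g, 'x) monoid_scheme \<Rightarrow> ('g \<Rightarrow> nat, nat) module" where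
  "semimodule_B G =
    \<lparr>carrier = {0, 1}, mult = max, one = 0, zero = 0, add = max,
     smult = (\<lambda>r x. if \<exists>g\<in>carrier G. r g > 0 then x else 0)\<rparr>"

lemma semiring_nat_group_semiring:
  assumes "group G" and fin: "finite (carrier G)"
  shows "semiring (nat_group_semiring G)"
proof -
  interpret group G by fact
  let ?S = "nat_group_semiring G"
  have canc: "z \<otimes>\<^bsub>G\<^esub> (inv\<^bsub>G\<^esub> z \<otimes>\<^bsub>G\<^esub> x) = x" "inv\<^bsub>G\<^esub> z \<otimes>\<^bsub>G\<^esub> (z \<otimes>\<^bsub>G\<^esub> x) = x"
    if "z \<in> carrier G" "x \<in> carrier G" for z x
    using that by (simp_all flip: m_assoc)
  have assoc: "(\<Sum>y\<in>carrier G. (\<Sum>z\<in>carrier G. a z * b (inv\<^bsub>G\<^esub> z \<otimes>\<^bsub>G\<^esub> y)) * c (inv\<^bsub>G\<^esub> y \<otimes>\<^bsub>G\<^esub> x))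
      = (\<Sum>z\<in>carrier G. a z * (\<Sum>w\<in>carrier G. b w * c (inv\<^bsub>G\<^esub> w \<otimes>\<^bsub>G\<^esub> (inv\<^bsub>G\<^esub> z \<otimes>\<^bsub>G\<^esub> x))))"
    if x: "x \<in> carrier G" for a b c :: "'a \<Rightarrow> nat" and x
  proof -
    have "(\<Sum>y\<in>carrier G. (\<Sum>z\<in>carrier G. a z * b (inv\<^bsub>G\<^esub> z \<otimes>\<^bsub>G\<^esub> y)) * c (inv\<^bsub>G\<^esub> y \<otimes>\<^bsub>G\<^esub> x))
      = (\<Sum>z\<in>carrier G. \<Sum>y\<in>carrier G. a z * (b (inv\<^bsub>G\<^esub> z \<otimes>\<^bsub>G\<^esub> y) * c (inv\<^bsub>G\<^esub> y \<otimes>\<^bsub>G\<^esub> x)))"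
      by (subst sum.swap) (simp add: sum_distrib_right mult.assoc)
    also have "\<dots> = (\<Sum>z\<in>carrier G. \<Sum>w\<in>carrier G.
        a z * (b w * c (inv\<^bsub>G\<^esub> w \<otimes>\<^bsub>G\<^esub> (inv\<^bsub>G\<^esub> z \<otimes>\<^bsub>G\<^esub> x))))"
    proof (rule sum.cong[OF refl])
      fix z assume z: "z \<in> carrier G"
      show "(\<Sum>y\<in>carrier G. a z * (b (inv\<^bsub>G\<^esub> z \<otimes>\<^bsub>G\<^esub> y) * c (inv\<^bsub>G\<^esub> y \<otimes>\<^bsub>G\<^esub> x)))
        = (\<Sum>w\<in>carrier G. a z * (b w * c (inv\<^bsub>G\<^esub> w \<otimes>\<^bsub>G\<^esub> (inv\<^bsub>G\<^esub> z \<otimes>\<^bsub>G\<^esub> x))))"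
        by (rule sum.reindex_bij_witness[where i = "\<lambda>w. z \<otimes>\<^bsub>G\<^esub> w" and j = "\<lambda>y. inv\<^bsub>G\<^esub> z \<otimes>\<^bsub>G\<^esub> y"])
           (use x z in \<open>auto simp: inv_mult_group m_assoc canc\<close>)
    qed
    finally show ?thesis by (simp add: sum_distrib_left)
  qed
  have delta: "(\<Sum>y\<in>carrier G. r y * (if inv\<^bsub>G\<^esub> y \<otimes>\<^bsub>G\<^esub> x = \<one>\<^bsub>G\<^esub> then 1 else 0)) = r x"
    if x: "x \<in> carrier G" for r :: "'a \<Rightarrow> nat" and x
  proof -
    have "(\<Sum>y\<in>carrier G. r y * (if inv\<^bsub>G\<^esub> y \<otimes>\<^bsub>G\<^esub> x = \<one>\<^bsub>G\<^esub> then 1 else 0))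
      = (\<Sum>y\<in>carrier G. if x = y then r y else 0)"
    proof (rule sum.cong[OF refl])
      fix y assume y: "y \<in> carrier G"
      have "inv\<^bsub>G\<^esub> y \<otimes>\<^bsub>G\<^esub> x = \<one>\<^bsub>G\<^esub> \<longleftrightarrow> x = y"
        using x y by (metis inv_closed l_inv inv_equality inv_inv)
      then show "r y * (if inv\<^bsub>G\<^esub> y \<otimes>\<^bsub>G\<^esub> x = \<one>\<^bsub>G\<^esub> then 1 else 0) = (if x = y then r y else 0)"
        by simp
    qed
    then show ?thesis using x fin by simp
  qed
  have delta': "(\<Sum>y\<in>carrier G. (if y = \<one>\<^bsub>G\<^esub> then 1 else 0) * r (inv\<^bsub>G\<^esub> y \<otimes>\<^bsub>G\<^esub> x)) = r x"
    if x: "x \<in> carrier G" for r :: "'a \<Rightarrow> nat" and x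
  proof -
    have "(\<Sum>y\<in>carrier G. (if y = \<one>\<^bsub>G\<^esub> then 1 else 0) * r (inv\<^bsub>G\<^esub> y \<otimes>\<^bsub>G\<^esub> x))
      = (\<Sum>y\<in>carrier G. if y = \<one>\<^bsub>G\<^esub> then r (inv\<^bsub>G\<^esub> y \<otimes>\<^bsub>G\<^esub> x) else 0)"
      by (rule sum.cong) auto
    then show ?thesis using x fin by simp
  qed
  show ?thesis
  proof unfold_locales
    fix x y z
    show "x \<otimes>\<^bsub>?S\<^esub> y \<otimes>\<^bsub>?S\<^esub> z = x \<otimes>\<^bsub>?S\<^esub> (y \<otimes>\<^bsub>?S\<^esub> z)"
      by (simp add: nat_group_semiring_def fun_eq_iff restrict_def assoc cong: sum.cong)
  next
    fix x assume "x \<in> carrier ?S"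
    then show "\<one>\<^bsub>?S\<^esub> \<otimes>\<^bsub>?S\<^esub> x = x" and "x \<otimes>\<^bsub>?S\<^esub> \<one>\<^bsub>?S\<^esub> = x"
      by (auto simp: nat_group_semiring_def fun_eq_iff restrict_def PiE_def extensional_def
          delta delta' cong: sum.cong)
  qed (auto simp: nat_group_semiring_def fun_eq_iff restrict_def PiE_def extensional_def
         sum.distrib algebra_simps Units_def cong: sum.cong)
qed

lemma semimodule_semimodule_B:
  assumes "group G" and fin: "finite (carrier G)"
  shows "semimodule (nat_group_semiring G) (semimodule_B G)"
proof -
  interpret group G by fact
  interpret S: semiring "nat_group_semiring G" by (rule semiring_nat_group_semiring) fact+
  have conv: "(\<exists>x\<in>carrier G. \<exists>y\<in>carrier G. 0 < a y \<and> 0 < b (inv\<^bsub>G\<^esub> y \<otimes>\<^bsub>G\<^esub> x)) \<longleftrightarrow>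
      (\<exists>y\<in>carrier G. 0 < a y) \<and> (\<exists>z\<in>carrier G. 0 < b z)" (is "?L \<longleftrightarrow> ?R")
    for a b :: "'a \<Rightarrow> nat"
  proof
    assume ?R
    then obtain y z where yz: "y \<in> carrier G" "0 < a y" "z \<in> carrier G" "0 < b z" by blast
    then have "inv\<^bsub>G\<^esub> y \<otimes>\<^bsub>G\<^esub> (y \<otimes>\<^bsub>G\<^esub> z) = z" by (simp add: m_assoc[symmetric])
    with yz show ?L by (metis m_closed)
  qed blast
  have "comm_monoid (add_monoid (semimodule_B G))"
    by unfold_locales (auto simp: semimodule_B_def)
  then interpret M: abelian_monoid "semimodule_B G" by (rule abelian_monoid.intro)
  have act: "a \<odot>\<^bsub>semimodule_B G\<^esub> x = (if \<exists>g\<in>carrier G. a g > 0 then x else 0)" for a x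
    by (simp add: semimodule_B_def)
  show ?thesis
  proof unfold_locales
    fix a b x
    have "(\<exists>g\<in>carrier G. 0 < (a \<otimes>\<^bsub>nat_group_semiring G\<^esub> b) g) \<longleftrightarrow>
      (\<exists>x\<in>carrier G. \<exists>y\<in>carrier G. 0 < a y \<and> 0 < b (inv\<^bsub>G\<^esub> y \<otimes>\<^bsub>G\<^esub> x))"
      by (rule bex_cong[OF refl])
         (auto simp: nat_group_semiring_def sum_eq_0_iff[OF fin] simp flip: neq0_conv)
    then show "(a \<otimes>\<^bsub>nat_group_semiring G\<^esub> b) \<odot>\<^bsub>semimodule_B G\<^esub> x =
        a \<odot>\<^bsub>semimodule_B G\<^esub> (b \<odot>\<^bsub>semimodule_B G\<^esub> x)"
      unfolding act conv by auto
  qed (auto simp: act, auto simp: semimodule_B_def nat_group_semiring_def dest: bspec[OF _ one_closed])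
qed

lemma nat_acts_on_B:
  assumes "group G"
  shows "nat_group_monom G i \<one>\<^bsub>G\<^esub> \<odot>\<^bsub>semimodule_B G\<^esub> x = (if i = 0 then 0 else x)"
proof -
  interpret group G by fact
  show ?thesis by (auto simp: semimodule_B_def nat_group_monom_def)
qed

lemma group_acts_on_B:
  assumes "g \<in> carrier G"
  shows "nat_group_monom G 1 g \<odot>\<^bsub>semimodule_B G\<^esub> x = x"
  using assms by (auto simp: semimodule_B_def nat_group_monom_def)

end

theory Submission
  imports Defs
begin

text \<open>
  The whole proof turns on the additive units of \<open>M\<close>, the elements that have a negative. They form
  a subsemimodule, and the relation of differing by an additive unit is a congruence. A minimal or
  elementary semimodule therefore either consists of additive units, which makes it a module, or
  has no additive unit besides \<open>0\<close> (\<open>minimal_add_Units_dichotomy\<close>,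
  \<open>elementary_add_Units_dichotomy\<close>). For a proper \<open>M\<close> the second case holds: a sum vanishes only
  if all its summands do.

  In that situation \<open>r x = 0\<close> forces \<open>r = 0\<close> or \<open>x = 0\<close>: if \<open>g\<close> occurs in \<open>r\<close>, then \<open>g x\<close> is a
  summand of \<open>r x\<close>, and \<open>g\<close> acts invertibly. So ``zero or non-zero'' is compatible with all
  operations, that is, the indicator of the non-zero elements is a surjective homomorphism from
  \<open>M\<close> to the Boolean semimodule (\<open>nonzero_indicator_hom\<close>), and what remains is that \<open>M\<close> has only
  one non-zero element. If \<open>M\<close> is elementary, this is immediate, because the kernel of a non-zero
  homomorphism is the equality relation. If \<open>M\<close> is minimal, it is generated by each of its
  non-zero elements. For the element \<open>\<nu> = \<Sum>\<^sub>g g\<close> and \<open>m \<noteq> 0\<close>, the multiples of \<open>\<nu> m\<close> form a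
  subsemimodule on which \<open>G\<close> acts trivially; since \<open>2 \<nu> m\<close> generates as well,
  \<open>\<nu> m = 2 j \<nu> m\<close> for some \<open>j > 0\<close>, and then \<open>(2 j - 1) \<nu> m\<close> is a non-zero idempotent. Its only
  multiples are \<open>0\<close> and itself, so it is the only non-zero element of \<open>M\<close>.

  Conversely, a two-element semimodule has no room for further subsemimodules or congruences.
\<close>

section \<open>Additive units of minimal and elementary semimodules\<close>

lemma semimodule_congruenceI:
  assumes "equiv (carrier M) E"
    and "\<And>m n k. (m, n) \<in> E \<Longrightarrow> k \<in> carrier M \<Longrightarrow> (m \<oplus>\<^bsub>M\<^esub> k, n \<oplus>\<^bsub>M\<^esub> k) \<in> E"
    and "\<And>m n a. (m, n) \<in> E \<Longrightarrow> a \<in> carrier R \<Longrightarrow> (a \<odot>\<^bsub>M\<^esub> m, a \<odot>\<^bsub>M\<^esub> n) \<in> E"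
  shows "semimodule_congruence R M E"
  using assms unfolding semimodule_congruence_def by auto

context semimodule
begin

lemma add_Units_iff:
  "x \<in> Units (add_monoid M) \<longleftrightarrow>
     x \<in> carrier M \<and> (\<exists>y\<in>carrier M. x \<oplus>\<^bsub>M\<^esub> y = \<zero>\<^bsub>M\<^esub>)"
  by (auto simp: Units_def) (metis M.a_comm)

lemma smult_add_Units:
  assumes "a \<in> carrier R" and "x \<in> Units (add_monoid M)"
  shows "a \<odot>\<^bsub>M\<^esub> x \<in> Units (add_monoid M)"
proof -
  obtain y where "x \<in> carrier M" "y \<in> carrier M" "x \<oplus>\<^bsub>M\<^esub> y = \<zero>\<^bsub>M\<^esub>"
    using assms(2) unfolding add_Units_iff by blast
  then show ?thesis
    using assms(1) unfolding add_Units_iff by (metis smult_closed smult_r_distr smult_r_null)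
qed

lemma subsemimodule_add_Units: "subsemimodule R (Units (add_monoid M)) M"
  using M.add.Units_m_closed M.add.Units_one_closed M.add.Units_closed smult_add_Units
  unfolding subsemimodule_def by (auto intro!: submonoid.intro)

lemma abelian_group_if_add_Units:
  assumes "Units (add_monoid M) = carrier M"
  shows "abelian_group M"
  by unfold_locales (use assms in auto)

lemma minimal_add_Units_dichotomy:
  assumes "minimal_semimodule R M"
  shows "Units (add_monoid M) = {\<zero>\<^bsub>M\<^esub>} \<or> abelian_group M"
  using assms subsemimodule_add_Units abelian_group_if_add_Units
  unfolding minimal_semimodule_def by blast

lemma semimodule_congruence_add_Units:
  "semimodule_congruence R M
    {(m, n). m \<in> carrier M \<and> n \<in> carrier M \<and> (\<exists>u\<in>Units (add_monoid M). m = n \<oplus>\<^bsub>M\<^esub> u)}"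
    (is "semimodule_congruence R M ?E")
proof -
  have "equiv (carrier M) ?E"
  proof (rule equivI)
    show "refl_on (carrier M) ?E"
    proof (rule refl_onI, clarify)
      fix m assume m: "m \<in> carrier M"
      show "\<exists>u\<in>Units (add_monoid M). m = m \<oplus>\<^bsub>M\<^esub> u"
        by (rule bexI[of _ "\<zero>\<^bsub>M\<^esub>"]) (use m M.add.Units_one_closed in simp_all)
    qed
    show "sym ?E"
    proof (rule symI, clarify)
      fix n u assume n: "n \<in> carrier M" and u: "u \<in> Units (add_monoid M)"
      then obtain v where v: "v \<in> carrier M" "u \<in> carrier M" "u \<oplus>\<^bsub>M\<^esub> v = \<zero>\<^bsub>M\<^esub>"
        unfolding add_Units_iff by blast
      have "v \<in> Units (add_monoid M)"
        unfolding add_Units_iff using v by (metis M.a_comm)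
      moreover have "n = n \<oplus>\<^bsub>M\<^esub> u \<oplus>\<^bsub>M\<^esub> v"
        using n v by (simp add: M.a_assoc)
      ultimately show "\<exists>w\<in>Units (add_monoid M). n = n \<oplus>\<^bsub>M\<^esub> u \<oplus>\<^bsub>M\<^esub> w" by blast
    qed
    show "trans ?E"
    proof (rule transI, clarify)
      fix n u v
      assume "n \<in> carrier M" "u \<in> Units (add_monoid M)" "v \<in> Units (add_monoid M)"
      then show "\<exists>w\<in>Units (add_monoid M). n \<oplus>\<^bsub>M\<^esub> u \<oplus>\<^bsub>M\<^esub> v = n \<oplus>\<^bsub>M\<^esub> w"
        using M.add.Units_m_closed M.add.Units_closed
        by (intro bexI[of _ "u \<oplus>\<^bsub>M\<^esub> v"]) (auto simp: M.a_assoc)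
    qed
  qed auto
  moreover have "(m \<oplus>\<^bsub>M\<^esub> k, n \<oplus>\<^bsub>M\<^esub> k) \<in> ?E" if mn: "(m, n) \<in> ?E" and k: "k \<in> carrier M" for m n k
  proof -
    obtain u where "n \<in> carrier M" "u \<in> Units (add_monoid M)" "m = n \<oplus>\<^bsub>M\<^esub> u"
      using mn by blast
    moreover from this have "m \<oplus>\<^bsub>M\<^esub> k = n \<oplus>\<^bsub>M\<^esub> k \<oplus>\<^bsub>M\<^esub> u"
      using k M.add.Units_closed by (simp add: M.a_ac)
    ultimately show ?thesis using mn k by blast
  qed
  moreover have "(a \<odot>\<^bsub>M\<^esub> m, a \<odot>\<^bsub>M\<^esub> n) \<in> ?E" if mn: "(m, n) \<in> ?E" and a: "a \<in> carrier R" for m n a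
  proof -
    obtain u where "n \<in> carrier M" "u \<in> Units (add_monoid M)" "m = n \<oplus>\<^bsub>M\<^esub> u"
      using mn by blast
    moreover from this have "a \<odot>\<^bsub>M\<^esub> m = a \<odot>\<^bsub>M\<^esub> n \<oplus>\<^bsub>M\<^esub> a \<odot>\<^bsub>M\<^esub> u"
      using a M.add.Units_closed by (simp add: smult_r_distr)
    ultimately show ?thesis using mn a smult_add_Units by blast
  qed
  ultimately show ?thesis by (rule semimodule_congruenceI)
qed

text \<open>The class of \<open>0\<close> under this congruence is the set of additive units, so the two
  possibilities for the congruence are the two possibilities for that set.\<close>

lemma elementary_add_Units_dichotomy:
  assumes "elementary_semimodule R M"
  shows "Units (add_monoid M) = {\<zero>\<^bsub>M\<^esub>} \<or> abelian_group M"
proof -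
  let ?E = "{(m, n). m \<in> carrier M \<and> n \<in> carrier M \<and>
    (\<exists>u\<in>Units (add_monoid M). m = n \<oplus>\<^bsub>M\<^esub> u)}"
  have unit_iff: "x \<in> Units (add_monoid M) \<longleftrightarrow> (x, \<zero>\<^bsub>M\<^esub>) \<in> ?E" for x
    using M.add.Units_closed by auto
  consider "?E = Id_on (carrier M)" | "?E = carrier M \<times> carrier M"
    using assms semimodule_congruence_add_Units unfolding elementary_semimodule_def by blast
  then show ?thesis
  proof cases
    case 1
    then have "Units (add_monoid M) = {\<zero>\<^bsub>M\<^esub>}" unfolding set_eq_iff unit_iff by auto
    then show ?thesis ..
  next
    case 2
    then have "Units (add_monoid M) = carrier M" unfolding set_eq_iff unit_iff by auto
    then show ?thesis using abelian_group_if_add_Units by blast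
  qed
qed

section \<open>Cyclic subsemimodules, kernels, two-element semimodules\<close>

lemma subsemimodule_cyclic:
  assumes "x \<in> carrier M"
  shows "subsemimodule R ((\<lambda>a. a \<odot>\<^bsub>M\<^esub> x) ` carrier R) M"
  unfolding subsemimodule_def
proof (intro conjI ballI)
  show "submonoid ((\<lambda>a. a \<odot>\<^bsub>M\<^esub> x) ` carrier R) (add_monoid M)"
  proof (rule submonoid.intro)
    show "\<one>\<^bsub>add_monoid M\<^esub> \<in> (\<lambda>a. a \<odot>\<^bsub>M\<^esub> x) ` carrier R"
      using assms by (auto intro!: image_eqI[of _ _ "\<zero>\<^bsub>R\<^esub>"])
  qed (use assms in \<open>auto simp flip: smult_l_distr\<close>)
qed (use assms in \<open>auto simp flip: smult_assoc1\<close>)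

lemma minimal_cyclic:
  assumes "minimal_semimodule R M" and "x \<in> carrier M" and "x \<noteq> \<zero>\<^bsub>M\<^esub>"
  shows "(\<lambda>a. a \<odot>\<^bsub>M\<^esub> x) ` carrier R = carrier M"
proof -
  have "x \<in> (\<lambda>a. a \<odot>\<^bsub>M\<^esub> x) ` carrier R"
    using assms(2) by (auto intro!: image_eqI[of _ _ "\<one>\<^bsub>R\<^esub>"])
  then show ?thesis
    using assms subsemimodule_cyclic unfolding minimal_semimodule_def by blast
qed

lemma semimodule_congruence_kernel:
  assumes "f \<in> semimodule_hom R M N"
  shows "semimodule_congruence R M {(m, n). m \<in> carrier M \<and> n \<in> carrier M \<and> f m = f n}"
  using assms unfolding semimodule_congruence_def semimodule_hom_def
  by (auto simp: equiv_def refl_on_def sym_def trans_def hom_def)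

lemma elementary_hom_inj_on:
  assumes "elementary_semimodule R M" and "f \<in> semimodule_hom R M N"
    and "x \<in> carrier M" and "f x \<noteq> \<zero>\<^bsub>N\<^esub>"
  shows "inj_on f (carrier M)"
proof -
  let ?E = "{(m, n). m \<in> carrier M \<and> n \<in> carrier M \<and> f m = f n}"
  have "(x, \<zero>\<^bsub>M\<^esub>) \<notin> ?E" using assms(2,4) by (simp add: semimodule_hom_def)
  then have "?E = Id_on (carrier M)"
    using assms(1,3) semimodule_congruence_kernel[OF assms(2)]
    unfolding elementary_semimodule_def by blast
  then show ?thesis by (auto simp: inj_on_def set_eq_iff Id_on_iff)
qed

lemma simple_if_two_elements:
  assumes car: "carrier M = {\<zero>\<^bsub>M\<^esub>, e}" and "e \<noteq> \<zero>\<^bsub>M\<^esub>"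
  shows "simple_semimodule R M"
proof -
  have "N = {\<zero>\<^bsub>M\<^esub>} \<or> N = carrier M" if "subsemimodule R N M" for N
  proof -
    have "N \<subseteq> carrier M" "\<zero>\<^bsub>M\<^esub> \<in> N"
      using that submonoid.subset submonoid.one_closed unfolding subsemimodule_def by fastforce+
    then show ?thesis using car by auto
  qed
  moreover have "E = Id_on (carrier M) \<or> E = carrier M \<times> carrier M"
    if "semimodule_congruence R M E" for E
  proof -
    have eq: "equiv (carrier M) E" using that unfolding semimodule_congruence_def by blast
    then have sub: "E \<subseteq> carrier M \<times> carrier M" and refl: "Id_on (carrier M) \<subseteq> E"
      and sym: "(x, y) \<in> E \<Longrightarrow> (y, x) \<in> E" for x y
      by (auto simp: equiv_def refl_on_def sym_def)
    show ?thesis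
    proof (cases "(\<zero>\<^bsub>M\<^esub>, e) \<in> E")
      case True
      then have "carrier M \<times> carrier M \<subseteq> E" using sym refl car by auto
      then show ?thesis using sub by blast
    next
      case False
      then have "E \<subseteq> Id_on (carrier M)" using sym sub car by auto
      then show ?thesis using refl by blast
    qed
  qed
  ultimately show ?thesis
    using assms semimodule_axioms
    unfolding simple_semimodule_def minimal_semimodule_def elementary_semimodule_def by auto
qed

end

section \<open>The group semiring and its constant elements\<close>

text \<open>These are the multiples of \<open>\<nu> = \<Sum>\<^sub>g g\<close>. They form a left ideal on which a semiring element
  acts through the sum of its coefficients, so they make available the multiples of
  \<open>G\<close>-invariant elements without any decomposition of \<open>r\<close> into monomials.\<close>

definition const_elem :: "('g, 'x) monoid_scheme \<Rightarrow> nat \<Rightarrow> 'g \<Rightarrow> nat" where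
  "const_elem G k = (\<lambda>x\<in>carrier G. k)"

lemma const_elem_closed [simp]: "const_elem G k \<in> carrier (nat_group_semiring G)"
  by (simp add: const_elem_def nat_group_semiring_def)

lemma const_elem_add:
  "const_elem G (j + k) = const_elem G j \<oplus>\<^bsub>nat_group_semiring G\<^esub> const_elem G k"
  by (auto simp: const_elem_def nat_group_semiring_def)

lemma mult_const_elem:
  assumes "group G"
  shows "r \<otimes>\<^bsub>nat_group_semiring G\<^esub> const_elem G k = const_elem G ((\<Sum>g\<in>carrier G. r g) * k)"
proof -
  interpret group G by fact
  show ?thesis
    by (auto simp: const_elem_def nat_group_semiring_def sum_distrib_right intro!: restrict_ext sum.cong)
qed

lemma nat_group_monom_closed [simp]: "nat_group_monom G i g \<in> carrier (nat_group_semiring G)"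
  by (simp add: nat_group_monom_def nat_group_semiring_def)

lemma nat_group_monom_inv_mult:
  assumes "group G" and "finite (carrier G)" and g: "g \<in> carrier G"
  shows "nat_group_monom G 1 (inv\<^bsub>G\<^esub> g) \<otimes>\<^bsub>nat_group_semiring G\<^esub> nat_group_monom G 1 g =
    \<one>\<^bsub>nat_group_semiring G\<^esub>"
proof -
  interpret group G by fact
  have "(\<Sum>y\<in>carrier G. nat_group_monom G 1 (inv\<^bsub>G\<^esub> g) y *
      nat_group_monom G 1 g (inv\<^bsub>G\<^esub> y \<otimes>\<^bsub>G\<^esub> x)) = (if x = \<one>\<^bsub>G\<^esub> then 1 else 0)"
    if x: "x \<in> carrier G" for x
  proof -
    have "(\<Sum>y\<in>carrier G. nat_group_monom G 1 (inv\<^bsub>G\<^esub> g) y *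
        nat_group_monom G 1 g (inv\<^bsub>G\<^esub> y \<otimes>\<^bsub>G\<^esub> x))
      = (\<Sum>y\<in>carrier G. if y = inv\<^bsub>G\<^esub> g then nat_group_monom G 1 g (g \<otimes>\<^bsub>G\<^esub> x) else 0)"
      using g by (intro sum.cong) (auto simp: nat_group_monom_def)
    also have "\<dots> = nat_group_monom G 1 g (g \<otimes>\<^bsub>G\<^esub> x)"
      using g assms(2) by simp
    also have "\<dots> = (if x = \<one>\<^bsub>G\<^esub> then 1 else 0)"
      using g x by (auto simp: nat_group_monom_def)
    finally show ?thesis .
  qed
  then show ?thesis
    by (auto simp: nat_group_semiring_def intro!: restrict_ext)
qed

lemma nat_group_semiring_split_monom:
  assumes "r \<in> carrier (nat_group_semiring G)" and "r g > 0"
  obtains s where "s \<in> carrier (nat_group_semiring G)"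
    and "r = nat_group_monom G 1 g \<oplus>\<^bsub>nat_group_semiring G\<^esub> s"
proof
  let ?s = "\<lambda>x\<in>carrier G. if x = g then r x - 1 else r x"
  show "?s \<in> carrier (nat_group_semiring G)" by (simp add: nat_group_semiring_def)
  show "r = nat_group_monom G 1 g \<oplus>\<^bsub>nat_group_semiring G\<^esub> ?s"
    using assms by (auto simp: nat_group_semiring_def nat_group_monom_def PiE_iff extensional_def fun_eq_iff)
qed

section \<open>Semimodules without non-zero additive units\<close>

locale zerosumfree_group_semimodule =
  semimodule "nat_group_semiring G" M
  for G :: "('g, 'x) monoid_scheme" and M :: "('g \<Rightarrow> nat, 'm, 'y) module_scheme" +
  assumes group_G: "group G" and finite_G: "finite (carrier G)"
    and add_Units_trivial: "Units (add_monoid M) = {\<zero>\<^bsub>M\<^esub>}"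
begin

lemma add_eq_zero_iff:
  assumes "x \<in> carrier M" and "y \<in> carrier M"
  shows "x \<oplus>\<^bsub>M\<^esub> y = \<zero>\<^bsub>M\<^esub> \<longleftrightarrow> x = \<zero>\<^bsub>M\<^esub> \<and> y = \<zero>\<^bsub>M\<^esub>"
proof
  assume sum: "x \<oplus>\<^bsub>M\<^esub> y = \<zero>\<^bsub>M\<^esub>"
  then have "x \<in> Units (add_monoid M)" using assms unfolding add_Units_iff by blast
  then show "x = \<zero>\<^bsub>M\<^esub> \<and> y = \<zero>\<^bsub>M\<^esub>" using sum assms add_Units_trivial by simp
qed simp

text \<open>If \<open>g\<close> occurs in \<open>r\<close>, then \<open>g x\<close> is a summand of \<open>r x\<close>, hence vanishes together with it, and
  \<open>x\<close> is recovered from \<open>g x\<close> by the action of the inverse of \<open>g\<close>.\<close>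

lemma smult_eq_zero_iff:
  assumes r: "r \<in> carrier (nat_group_semiring G)" and x: "x \<in> carrier M"
  shows "r \<odot>\<^bsub>M\<^esub> x = \<zero>\<^bsub>M\<^esub> \<longleftrightarrow> (\<forall>g\<in>carrier G. r g = 0) \<or> x = \<zero>\<^bsub>M\<^esub>"
proof
  assume zero: "r \<odot>\<^bsub>M\<^esub> x = \<zero>\<^bsub>M\<^esub>"
  show "(\<forall>g\<in>carrier G. r g = 0) \<or> x = \<zero>\<^bsub>M\<^esub>"
  proof (cases "\<forall>g\<in>carrier G. r g = 0")
    case False
    then obtain g where g: "g \<in> carrier G" "r g > 0" by auto
    obtain s where s: "s \<in> carrier (nat_group_semiring G)"
      and rs: "r = nat_group_monom G 1 g \<oplus>\<^bsub>nat_group_semiring G\<^esub> s"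
      using nat_group_semiring_split_monom[OF r g(2)] .
    have "nat_group_monom G 1 g \<odot>\<^bsub>M\<^esub> x = \<zero>\<^bsub>M\<^esub>"
      using zero s x by (simp add: rs smult_l_distr add_eq_zero_iff)
    moreover have "nat_group_monom G 1 (inv\<^bsub>G\<^esub> g) \<odot>\<^bsub>M\<^esub> (nat_group_monom G 1 g \<odot>\<^bsub>M\<^esub> x) = x"
      using x by (simp add: nat_group_monom_inv_mult[OF group_G finite_G g(1)]
          flip: smult_assoc1 del: One_nat_def)
    ultimately show ?thesis by simp
  qed simp
next
  assume "(\<forall>g\<in>carrier G. r g = 0) \<or> x = \<zero>\<^bsub>M\<^esub>"
  moreover have "r = \<zero>\<^bsub>nat_group_semiring G\<^esub>" if "\<forall>g\<in>carrier G. r g = 0"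
    using that r by (auto simp: nat_group_semiring_def PiE_iff extensional_def fun_eq_iff)
  ultimately show "r \<odot>\<^bsub>M\<^esub> x = \<zero>\<^bsub>M\<^esub>" using r x by auto
qed

lemma nonzero_indicator_hom:
  "(\<lambda>x. if x = \<zero>\<^bsub>M\<^esub> then 0 else 1) \<in> semimodule_hom (nat_group_semiring G) M (semimodule_B G)"
  by (auto simp: semimodule_hom_def hom_def semimodule_B_def add_eq_zero_iff smult_eq_zero_iff)

lemma isomorphic_B_if_inj:
  assumes "inj_on (\<lambda>x. if x = \<zero>\<^bsub>M\<^esub> then 0 else 1::nat) (carrier M)"
    and "carrier M \<noteq> {\<zero>\<^bsub>M\<^esub>}"
  shows "semimodule_isomorphic (nat_group_semiring G) M (semimodule_B G)"
proof -
  obtain x where "x \<in> carrier M" "x \<noteq> \<zero>\<^bsub>M\<^esub>" using assms(2) M.zero_closed by blast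
  then have "(\<lambda>x. if x = \<zero>\<^bsub>M\<^esub> then 0 else 1) ` carrier M = carrier (semimodule_B G)"
    using M.zero_closed by (auto simp: semimodule_B_def image_iff)
  then show ?thesis
    using assms(1) nonzero_indicator_hom unfolding semimodule_isomorphic_def bij_betw_def by blast
qed

lemma elementary_isomorphic_B:
  assumes "elementary_semimodule (nat_group_semiring G) M"
  shows "semimodule_isomorphic (nat_group_semiring G) M (semimodule_B G)"
proof (rule isomorphic_B_if_inj)
  show nonzero: "carrier M \<noteq> {\<zero>\<^bsub>M\<^esub>}" using assms unfolding elementary_semimodule_def by blast
  then obtain x where "x \<in> carrier M" "x \<noteq> \<zero>\<^bsub>M\<^esub>" using M.zero_closed by blast
  then show "inj_on (\<lambda>x. if x = \<zero>\<^bsub>M\<^esub> then 0 else 1::nat) (carrier M)"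
    by (intro elementary_hom_inj_on[OF assms nonzero_indicator_hom]) (auto simp: semimodule_B_def)
qed

text \<open>Every non-zero element generates, in particular \<open>2 \<nu> m\<close> does, so \<open>\<nu> m\<close> is an even multiple \<open>2 j \<nu> m\<close> of itself. Adding
  \<open>(2 j - 2) \<nu> m\<close> on both sides shows that \<open>(2 j - 1) \<nu> m\<close> is idempotent; its positive multiples
  all coincide with it, and they are all the non-zero elements of \<open>M\<close>.\<close>

lemma minimal_two_elements:
  assumes min: "minimal_semimodule (nat_group_semiring G) M"
  obtains e where "carrier M = {\<zero>\<^bsub>M\<^esub>, e}"
proof -
  interpret group G by (rule group_G)
  obtain m where m: "m \<in> carrier M" "m \<noteq> \<zero>\<^bsub>M\<^esub>"
    using min M.zero_closed unfolding minimal_semimodule_def by blast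
  define c where "c k = const_elem G k \<odot>\<^bsub>M\<^esub> m" for k
  have c_closed [simp]: "c k \<in> carrier M" for k using m by (simp add: c_def)
  have c_zero_iff: "c k = \<zero>\<^bsub>M\<^esub> \<longleftrightarrow> k = 0" for k
    using m one_closed by (auto simp: c_def smult_eq_zero_iff) (auto simp: const_elem_def)
  have c_add: "c (j + k) = c j \<oplus>\<^bsub>M\<^esub> c k" for j k
    using m by (simp add: c_def const_elem_add smult_l_distr)
  have generates: "\<exists>j. x = c (j * k)" if "k > 0" "x \<in> carrier M" for k x
  proof -
    have "x \<in> (\<lambda>a. a \<odot>\<^bsub>M\<^esub> c k) ` carrier (nat_group_semiring G)"
      using minimal_cyclic[OF min, of "c k"] that c_zero_iff by simp
    then obtain r where "r \<in> carrier (nat_group_semiring G)" "x = r \<odot>\<^bsub>M\<^esub> c k" by blast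
    then have "x = c ((\<Sum>g\<in>carrier G. r g) * k)"
      using m by (simp add: c_def mult_const_elem[OF group_G] flip: smult_assoc1)
    then show ?thesis ..
  qed
  obtain j where j: "c 1 = c (j * 2)" using generates[of 2 "c 1"] by auto
  then have "j \<noteq> 0" using c_zero_iff[of 1] c_zero_iff[of "j * 2"] by auto
  define n where "n = 2 * j - 1"
  have n: "n > 0" "j * 2 = n + 1" "n = 1 + (n - 1)" using \<open>j \<noteq> 0\<close> by (auto simp: n_def)
  have idem: "c n \<oplus>\<^bsub>M\<^esub> c n = c n"
  proof -
    have "c n \<oplus>\<^bsub>M\<^esub> c n = c (j * 2 + (n - 1))" using n by (simp flip: c_add)
    also have "\<dots> = c 1 \<oplus>\<^bsub>M\<^esub> c (n - 1)" by (simp only: c_add j)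
    also have "\<dots> = c n" using n by (simp flip: c_add)
    finally show ?thesis .
  qed
  have multiple: "c (i * n) \<in> {\<zero>\<^bsub>M\<^esub>, c n}" for i
  proof (induction i)
    case 0
    then show ?case by (simp add: c_zero_iff)
  next
    case (Suc i)
    then show ?case using idem by (auto simp: c_add)
  qed
  have "carrier M = {\<zero>\<^bsub>M\<^esub>, c n}"
    using generates[OF n(1)] multiple by fastforce
  then show thesis by (rule that)
qed

lemma minimal_isomorphic_B:
  assumes "minimal_semimodule (nat_group_semiring G) M"
  shows "semimodule_isomorphic (nat_group_semiring G) M (semimodule_B G)"
proof (rule isomorphic_B_if_inj)
  show "carrier M \<noteq> {\<zero>\<^bsub>M\<^esub>}" using assms unfolding minimal_semimodule_def by blast
  obtain e where "carrier M = {\<zero>\<^bsub>M\<^esub>, e}" using minimal_two_elements[OF assms] .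
  then show "inj_on (\<lambda>x. if x = \<zero>\<^bsub>M\<^esub> then 0 else 1::nat) (carrier M)"
    by (auto simp: inj_on_def)
qed

end

section \<open>The equivalence\<close>

lemma (in semimodule) simple_if_isomorphic_two_elements:
  assumes "semimodule_isomorphic R M N" and "carrier N = {\<zero>\<^bsub>N\<^esub>, b}" and "b \<noteq> \<zero>\<^bsub>N\<^esub>"
  shows "simple_semimodule R M"
proof -
  obtain f where f: "f \<zero>\<^bsub>M\<^esub> = \<zero>\<^bsub>N\<^esub>" "bij_betw f (carrier M) {\<zero>\<^bsub>N\<^esub>, b}"
    using assms(1,2) unfolding semimodule_isomorphic_def semimodule_hom_def by auto
  then obtain e where e: "e \<in> carrier M" "f e = b"
    unfolding bij_betw_def by (metis imageE insertCI)
  have "x = \<zero>\<^bsub>M\<^esub> \<or> x = e" if "x \<in> carrier M" for x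
    using that f e M.zero_closed unfolding bij_betw_def inj_on_def by (metis imageI insertE singletonD)
  then have "carrier M = {\<zero>\<^bsub>M\<^esub>, e}" using e by auto
  moreover have "e \<noteq> \<zero>\<^bsub>M\<^esub>" using e f assms(3) by auto
  ultimately show ?thesis by (rule simple_if_two_elements)
qed

theorem proposition7p9:
  fixes G :: "('g, 'x) monoid_scheme"
    and M :: "('g \<Rightarrow> nat, 'm, 'y) module_scheme"
  assumes "group G" and "finite (carrier G)"
    and "proper_semimodule (nat_group_semiring G) M"
  shows "(minimal_semimodule (nat_group_semiring G) M \<longleftrightarrow>
            elementary_semimodule (nat_group_semiring G) M) \<and>
         (elementary_semimodule (nat_group_semiring G) M \<longleftrightarrow>
            simple_semimodule (nat_group_semiring G) M) \<and>
         (simple_semimodule (nat_group_semiring G) M \<longleftrightarrow>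
            semimodule_isomorphic (nat_group_semiring G) M (semimodule_B G))"
proof -
  interpret proper_semimodule "nat_group_semiring G" M by fact
  have zerosumfree: "zerosumfree_group_semimodule G M"
    if "Units (add_monoid M) = {\<zero>\<^bsub>M\<^esub>}"
    using that assms(1,2) semimodule_axioms
    by (intro zerosumfree_group_semimodule.intro zerosumfree_group_semimodule_axioms.intro)
  have "semimodule_isomorphic (nat_group_semiring G) M (semimodule_B G)"
    if "minimal_semimodule (nat_group_semiring G) M"
    using that minimal_add_Units_dichotomy not_abelian_group zerosumfree
      zerosumfree_group_semimodule.minimal_isomorphic_B by blast
  moreover have "semimodule_isomorphic (nat_group_semiring G) M (semimodule_B G)"
    if "elementary_semimodule (nat_group_semiring G) M"
    using that elementary_add_Units_dichotomy not_abelian_group zerosumfree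
      zerosumfree_group_semimodule.elementary_isomorphic_B by blast
  moreover have "simple_semimodule (nat_group_semiring G) M"
    if "semimodule_isomorphic (nat_group_semiring G) M (semimodule_B G)"
    using simple_if_isomorphic_two_elements[OF that, of 1] by (simp add: semimodule_B_def)
  ultimately show ?thesis
    unfolding simple_semimodule_def by blast
qed

end
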